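(* Let $0<a\le 1$ and let $\zeta(s,a)$ denote the Hurwitz zeta function. Define $$\psi(t)=\frac{te^{t}}{(e^{t}-1)^2}-\frac{1}{e^{t}-1}+\frac{(a-1)t}{e^{t}-1},\qquad t>0,$$ and, for $s\in\mathbb{C}$, set $S_{1}(s,a)=1$ and $$S_{n}(s,a)=\sum_{k=0}^{n-1}(-1)^{k}\binom{n-1}{k}(k+a)^{-s}\quad (n\ge 2).$$ Then for all $s\in\mathbb{C}$ with $\Re(s)>0$: (A) $\displaystyle (s-1)\zeta(s,a)=\frac{1}{\Gamma(s)}\int_{0}^{\infty}\psi(t)\, e^{-(a-1)t}\,t^{s-1}\,dt$; (B) $\displaystyle (s-1)\zeta(s,a)=\sum_{n=1}^{\infty}S_{n}(s,a)\left(\frac{1}{n+1}+\frac{a-1}{n}\right)$.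
   Context: For $0<a\le 1$, the Hurwitz zeta function is $\zeta(s,a)=\sum_{n=1}^{\infty}(n-1+a)^{-s}$ for $\Re(s)>1$, extended by analytic continuation to $\mathbb{C}$ with a single simple pole (residue $1$) at $s=1$; thus $(s-1)\zeta(s,a)$ extends to an entire function of $s$, and this is what the left-hand sides denote. Powers $(k+a)^{-s}$ and $t^{s-1}$ with positive real base use the principal (real) logarithm.
   Formalization: The printed convention S_1(s,a)=1 is replaced by S_1(s,a)=a^{-s} (the general formula at n=1); with S_1=1, (B) fails, e.g. at a=0.8, s=1 the series gives 0.925 instead of 1. *)

theory Defs
  imports "HOL-Complex_Analysis.Complex_Analysis"
begin

(* The analytic continuation to the punctured plane is unique there by the identity theorem.
   The value at the pole s = 1 is pinned to 0 only to make the function unique;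
   (s - 1) zeta(s, a) is formed below with remove_sings, which ignores that value. *)
definition hurwitz_zeta :: "real \<Rightarrow> complex \<Rightarrow> complex" where
  "hurwitz_zeta a = (THE f. f holomorphic_on (UNIV - {1}) \<and>
     (\<forall>s. Re s > 1 \<longrightarrow> f s = (\<Sum>n. complex_of_real (real n + a) powr (- s))) \<and>
     f 1 = 0)"

(* The entire extension of (s - 1) zeta(s, a). *)
definition hurwitz_zeta_entire :: "real \<Rightarrow> complex \<Rightarrow> complex" where
  "hurwitz_zeta_entire a = remove_sings (\<lambda>s. (s - 1) * hurwitz_zeta a s)"

definition hurwitz_psi :: "real \<Rightarrow> real \<Rightarrow> real" where
  "hurwitz_psi a t =
     t * exp t / (exp t - 1)\<^sup>2 - 1 / (exp t - 1) + (a - 1) * t / (exp t - 1)"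

(* Only n >= 1 is relevant.  At n = 1 the sum is a powr (-s).  The value 1 sometimes given for
   S_1(s, a) is the case a = 1; for other a it would invalidate the series expansion. *)
definition hurwitz_S :: "nat \<Rightarrow> complex \<Rightarrow> real \<Rightarrow> complex" where
  "hurwitz_S n s a =
     (\<Sum>k<n. (- 1) ^ k * of_nat ((n - 1) choose k) * complex_of_real (real k + a) powr (- s))"

end

theory Submission
  imports Defs "HOL-Real_Asymp.Real_Asymp"
begin

text \<open>
  The function \<open>G t = t exp ((1 - a) t) / (exp t - 1)\<close> extends holomorphically to a neighbourhood of
  \<open>[0, \<infinity>)\<close> on which it decays exponentially, so by Cauchy's inequality all its derivatives decay
  exponentially on \<open>[0, \<infinity>)\<close>. For \<open>Re s > 1\<close>, expanding \<open>1 / (exp t - 1)\<close> into a geometric series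
  gives \<open>(s - 1) \<zeta>(s, a) = \<integral> G t * t powr (s - 2) dt / \<Gamma>(s - 1)\<close>. Integrating by parts \<open>k\<close> times turns
  this into an expression that is holomorphic for \<open>Re s > 1 - k\<close>, which provides the continuation to the
  whole plane. Since \<open>G' t = - \<psi> t * exp (- (a - 1) t)\<close>, the case \<open>k = 1\<close> is (A). Writing
  \<open>u = 1 - exp (- t)\<close> and \<open>t = - ln (1 - u)\<close>, the function \<open>- G' t\<close> becomes \<open>exp (- a t)\<close> times the power
  series \<open>\<Sum>n. (1 / (n + 1) + (a - 1) / n) u ^ (n - 1)\<close>, whose partial sums are dominated by \<open>G\<close>, and
  the integral of \<open>exp (- a t) u ^ (n - 1) t powr (s - 1)\<close> is \<open>\<Gamma>(s) S\<^sub>n(s, a)\<close> by the binomial theorem;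
  this is (B).
\<close>

section \<open>Mellin transforms of exponentially decaying functions\<close>

definition mellin :: "(real \<Rightarrow> complex) \<Rightarrow> complex \<Rightarrow> complex" where
  "mellin h s = (LINT t:{0<..}|lborel. h t * of_real t powr (s - 1))"

text \<open>The bound is required down to t = 0, so it also controls \<open>h\<close> near 0; this
  is what makes \<open>mellin h s\<close> converge whenever Re s > 0.\<close>

definition exp_decay :: "(real \<Rightarrow> complex) \<Rightarrow> bool" where
  "exp_decay h \<longleftrightarrow> continuous_on {0<..} h \<and>
     (\<exists>C c. c > 0 \<and> (\<forall>t>0. norm (h t) \<le> C * exp (- c * t)))"

lemma norm_powr_of_real: "t > 0 \<Longrightarrow> norm (complex_of_real t powr s) = t powr Re s"
  by (simp add: norm_powr_real_powr)

text \<open>The integral for Gamma is taken from the completed measure and complex values. Borel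
  measurability brings it to \<open>lborel\<close>, and taking norms gives the real majorant used
  for domination.\<close>

lemma set_integrable_exp_powr:
  assumes "c > 0" "x > 0"
  shows "set_integrable lborel {0<..} (\<lambda>t::real. exp (- c * t) * t powr (x - 1))"
proof -
  define f where "f = (\<lambda>t. indicator {0<..} t *\<^sub>R (complex_of_real t powr (of_real x - 1) / of_real (exp (c * t))))"
  have "integrable lebesgue f"
    using absolutely_integrable_Gamma_integral[of "of_real x" c] assms
    by (simp add: set_integrable_def f_def)
  moreover have "f \<in> borel_measurable borel"
    unfolding f_def
    by (intro borel_measurable_continuous_on_indicator continuous_intros) auto
  ultimately have "integrable lborel f"
    by (simp add: integrable_completion)
  hence "integrable lborel (\<lambda>t. norm (f t))"
    by (rule integrable_norm)
  also have "(\<lambda>t. norm (f t)) = (\<lambda>t. indicator {0<..} t *\<^sub>R (exp (- c * t) * t powr (x - 1)))"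
    by (auto simp: f_def indicator_def norm_divide norm_powr_of_real exp_minus field_simps)
  finally show ?thesis
    by (simp add: set_integrable_def)
qed

lemma exp_decayI:
  assumes "continuous_on {0<..} h" "c > 0" "\<And>t. t > 0 \<Longrightarrow> norm (h t) \<le> C * exp (- c * t)"
  shows "exp_decay h"
  using assms unfolding exp_decay_def by blast

lemma exp_decayE:
  assumes "exp_decay h"
  obtains C c where "C > 0" "c > 0" "\<And>t. t > 0 \<Longrightarrow> norm (h t) \<le> C * exp (- c * t)"
proof -
  from assms obtain C c where *: "c > 0" "\<And>t. t > 0 \<Longrightarrow> norm (h t) \<le> C * exp (- c * t)"
    unfolding exp_decay_def by blast
  have "norm (h t) \<le> max 1 C * exp (- c * t)" if "t > 0" for t
    using *(2)[OF that] by (rule order_trans) (auto intro: mult_right_mono)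
  thus thesis using that[of "max 1 C" c] *(1) by auto
qed

lemma set_borel_measurable_mellin:
  assumes "continuous_on {0<..} h"
  shows "(\<lambda>t. indicator {0<..} t *\<^sub>R (h t * complex_of_real t powr (s - 1))) \<in> borel_measurable borel"
  using assms by (intro borel_measurable_continuous_on_indicator continuous_intros) auto

lemma set_integrable_mellin:
  assumes "exp_decay h" "Re s > 0"
  shows "set_integrable lborel {0<..} (\<lambda>t. h t * of_real t powr (s - 1))"
proof -
  from assms(1) obtain C c where C: "C > 0" "c > 0" "\<And>t. t > 0 \<Longrightarrow> norm (h t) \<le> C * exp (- c * t)"
    by (auto elim: exp_decayE)
  have "set_integrable lborel {0<..} (\<lambda>t. C * (exp (- c * t) * t powr (Re s - 1)))"
    by (rule set_integrable_mult_right) (use set_integrable_exp_powr C assms in auto)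
  thus ?thesis
  proof (rule set_integrable_bound)
    show "set_borel_measurable lborel {0<..} (\<lambda>t. h t * of_real t powr (s - 1))"
      using set_borel_measurable_mellin[of h s] assms(1)
      by (simp add: set_borel_measurable_def exp_decay_def)
    show "AE t in lborel. t \<in> {0<..} \<longrightarrow> norm (h t * complex_of_real t powr (s - 1))
            \<le> norm (C * (exp (- c * t) * t powr (Re s - 1)))"
      using C by (auto intro!: AE_I2 mult_right_mono simp: norm_mult norm_powr_of_real mult.assoc[symmetric])
  qed
qed

text \<open>Truncated integrals over the compact sets \<open>K n\<close> are holomorphic by
  differentiation under the integral sign. They converge to \<open>mellin h\<close> uniformly on
  small discs, because their tails are bounded by the tails of one integrable function.\<close>

lemma holomorphic_mellin:
  assumes "exp_decay h"
  shows "mellin h holomorphic_on {s. Re s > 0}"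
proof (rule holomorphic_uniform_sequence)
  show "open {s. Re s > 0}"
    by (simp add: open_halfspace_Re_gt)
  have cont: "continuous_on {0<..} h"
    using assms by (simp add: exp_decay_def)
  define K where "K = (\<lambda>n::nat. {1 / Suc n .. real (Suc n)})"
  have K_sub: "K n \<subseteq> {0<..}" for n
    by (auto simp: K_def intro: less_le_trans[rotated])
  define f where "f = (\<lambda>n s. LINT t:K n|lborel. h t * of_real t powr (s - 1))"
  have cont_K: "continuous_on (K n) (\<lambda>t. h t * complex_of_real t powr (s - 1))" for n s
    by (intro continuous_intros continuous_on_subset[OF cont K_sub]) (use K_sub[of n] in auto)
  have f_eq: "f n s = integral (K n) (\<lambda>t. h t * of_real t powr (s - 1))" for n s
    unfolding f_def
    by (rule set_borel_integral_eq_integral(2), unfold K_def, rule borel_integrable_atLeastAtMost')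
       (use cont_K[of n] in \<open>simp add: K_def\<close>)
  show "f n holomorphic_on {s. Re s > 0}" for n
  proof -
    have "(\<lambda>s. integral (cbox (1 / Suc n) (real (Suc n))) (\<lambda>t. h t * of_real t powr (s - 1)))
            holomorphic_on {s. Re s > 0}"
    proof (rule leibniz_rule_holomorphic)
      fix s :: complex and t :: real assume "t \<in> cbox (1 / Suc n) (real (Suc n))"
      hence "t > 0" using K_sub[of n] by (auto simp: K_def)
      thus "((\<lambda>s. h t * complex_of_real t powr (s - 1)) has_field_derivative
              h t * (Ln (of_real t) * complex_of_real t powr (s - 1))) (at s within {s. Re s > 0})"
        by (auto intro!: derivative_eq_intros has_field_derivative_powr_right[THEN DERIV_chain2])
    next
      fix s :: complex
      show "(\<lambda>t. h t * complex_of_real t powr (s - 1)) integrable_on cbox (1 / Suc n) (real (Suc n))"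
        by (rule integrable_continuous) (use cont_K[of n] in \<open>simp add: K_def\<close>)
    next
      have sub: "cbox (1 / Suc n) (real (Suc n)) \<subseteq> {0<..}"
        using K_sub[of n] by (simp add: K_def)
      have "continuous_on ({s. Re s > 0} \<times> cbox (1 / Suc n) (real (Suc n))) (h \<circ> snd)"
        by (intro continuous_on_compose continuous_intros continuous_on_subset[OF cont])
           (use sub in auto)
      thus "continuous_on ({s. Re s > 0} \<times> cbox (1 / Suc n) (real (Suc n)))
              (\<lambda>(s, t). h t * (Ln (of_real t) * complex_of_real t powr (s - 1)))"
        unfolding case_prod_unfold o_def using sub
        by (intro continuous_intros) auto
      show "convex {s. Re s > 0}"
        by (simp add: convex_halfspace_Re_gt)
    qed
    thus ?thesis by (simp add: f_eq[abs_def] K_def)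
  qed
  fix s :: complex assume s: "s \<in> {s. Re s > 0}"
  \<comment> \<open>With this radius the closed disc around \<open>s\<close> stays in d <= Re w <= 3
    d, inside the half-plane.\<close>
  define d where "d = Re s / 2"
  have d: "d > 0" using s by (simp add: d_def)
  have Re_near: "d \<le> Re w \<and> Re w \<le> 3 * d" if "w \<in> cball s d" for w
    using that abs_Re_le_cmod[of "s - w"] by (auto simp: dist_norm d_def)
  from assms obtain C c where C: "C > 0" "c > 0" "\<And>t. t > 0 \<Longrightarrow> norm (h t) \<le> C * exp (- c * t)"
    by (auto elim: exp_decayE)
  \<comment> \<open>For t < 1 the smallest exponent occurring in the disc dominates, for t >= 1 the
    largest; the sum covers both.\<close>
  define W where "W = (\<lambda>t. C * (exp (- c * t) * t powr (d - 1)) + C * (exp (- c * t) * t powr (3 * d - 1)))"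
  have int_W: "set_integrable lborel {0<..} W"
    unfolding W_def
    by (intro set_integral_add set_integrable_mult_right)
       (use set_integrable_exp_powr[of c d] set_integrable_exp_powr[of c "3 * d"] C d in auto)
  have bound: "norm (h t * complex_of_real t powr (w - 1)) \<le> W t" if "t > 0" "w \<in> cball s d" for t w
  proof -
    have "t powr (Re w - 1) \<le> t powr (d - 1) + t powr (3 * d - 1)"
    proof (cases "t \<ge> 1")
      case True
      hence "t powr (Re w - 1) \<le> t powr (3 * d - 1)"
        using Re_near[OF that(2)] by (intro powr_mono) auto
      thus ?thesis by (simp add: add_increasing)
    next
      case False
      hence "t powr (Re w - 1) \<le> t powr (d - 1)"
        using Re_near[OF that(2)] that by (intro powr_mono') auto
      thus ?thesis by (simp add: add_increasing2)
    qed
    hence "norm (h t * complex_of_real t powr (w - 1))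
              \<le> (C * exp (- c * t)) * (t powr (d - 1) + t powr (3 * d - 1))"
      unfolding norm_mult using that C by (intro mult_mono) (auto simp: norm_powr_of_real)
    thus ?thesis by (simp add: W_def algebra_simps)
  qed
  define R where "R = (\<lambda>n. LINT t:{0<..} - K n|lborel. W t)"
  have int_R: "set_integrable lborel ({0<..} - K n) W" for n
    by (rule set_integrable_subset[OF int_W]) (auto simp: K_def)
  have diff: "norm (f n w - mellin h w) \<le> R n" if w: "w \<in> cball s d" for n w
  proof -
    have int: "set_integrable lborel {0<..} (\<lambda>t. h t * of_real t powr (w - 1))"
      using Re_near[OF w] d by (intro set_integrable_mellin assms) auto
    have int1: "set_integrable lborel (K n) (\<lambda>t. h t * of_real t powr (w - 1))"
      by (rule set_integrable_subset[OF int]) (use K_sub in \<open>auto simp: K_def\<close>)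
    have int2: "set_integrable lborel ({0<..} - K n) (\<lambda>t. h t * of_real t powr (w - 1))"
      by (rule set_integrable_subset[OF int]) (auto simp: K_def)
    have "{0<..} = K n \<union> ({0<..} - K n)" using K_sub[of n] by auto
    hence "mellin h w = f n w + (LINT t:{0<..} - K n|lborel. h t * of_real t powr (w - 1))"
      unfolding mellin_def f_def using set_integral_Un[OF _ int1 int2] by auto
    hence "norm (f n w - mellin h w) = norm (LINT t:{0<..} - K n|lborel. h t * of_real t powr (w - 1))"
      by simp
    also have "\<dots> \<le> (LINT t:{0<..} - K n|lborel. norm (h t * of_real t powr (w - 1)))"
      by (rule set_integral_norm_bound[OF int2])
    also have "\<dots> \<le> R n"
      unfolding R_def using int2 int_R bound[OF _ w]
      by (intro set_integral_mono) (auto simp: set_integrable_norm)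
    finally show ?thesis .
  qed
  \<comment> \<open>Dominated convergence: every fixed t > 0 lies in \<open>K n\<close> for all
    large n, so the integrand is eventually 0 there.\<close>
  have "R \<longlonglongrightarrow> (LINT t::real|lborel. 0)"
    unfolding R_def set_lebesgue_integral_def
  proof (rule integral_dominated_convergence[where f = "\<lambda>_. 0"
             and s = "\<lambda>n t. indicator ({0<..} - K n) t *\<^sub>R W t" and w = "\<lambda>t. indicator {0<..} t *\<^sub>R W t"])
    show "integrable lborel (\<lambda>t. indicat_real {0<..} t *\<^sub>R W t)"
      using int_W by (simp add: set_integrable_def)
    show "(\<lambda>t. indicat_real ({0<..} - K n) t *\<^sub>R W t) \<in> borel_measurable lborel" for n
      using int_R[of n] by (auto simp: set_integrable_def)
    have "(\<lambda>n. indicat_real ({0<..} - K n) t *\<^sub>R W t) \<longlonglongrightarrow> 0" for t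
    proof (cases "t > 0")
      case True
      have "eventually (\<lambda>n. inverse (real (Suc n)) < t) sequentially"
        using True by (intro order_tendstoD[OF LIMSEQ_inverse_real_of_nat])
      moreover have "eventually (\<lambda>n. real n > t) sequentially"
        using filterlim_at_top_dense filterlim_real_sequentially by blast
      ultimately have "eventually (\<lambda>n. indicat_real ({0<..} - K n) t *\<^sub>R W t = 0) sequentially"
        by eventually_elim (auto simp: K_def inverse_eq_divide)
      thus ?thesis by (rule tendsto_eventually)
    qed auto
    thus "AE t in lborel. (\<lambda>n. indicat_real ({0<..} - K n) t *\<^sub>R W t) \<longlonglongrightarrow> 0" by simp
    show "AE t in lborel. norm (indicat_real ({0<..} - K n) t *\<^sub>R W t) \<le> indicat_real {0<..} t *\<^sub>R W t" for n
      using C by (intro AE_I2) (auto simp: indicator_def W_def)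
  qed auto
  hence R0: "R \<longlonglongrightarrow> 0" by simp
  have "uniform_limit (cball s d) f (mellin h) sequentially"
  proof (rule uniform_limitI)
    fix e :: real assume "e > 0"
    hence "eventually (\<lambda>n. R n < e) sequentially"
      by (rule order_tendstoD[OF R0])
    thus "eventually (\<lambda>n. \<forall>w\<in>cball s d. dist (f n w) (mellin h w) < e) sequentially"
      by eventually_elim (use le_less_trans[OF diff] in \<open>auto simp: dist_norm\<close>)
  qed
  moreover have "cball s d \<subseteq> {s. Re s > 0}"
    using Re_near d by force
  ultimately show "\<exists>d>0. cball s d \<subseteq> {s. Re s > 0} \<and> uniform_limit (cball s d) f (mellin h) sequentially"
    using d by blast
qed

text \<open>Integration by parts: \<open>h t * of_real t powr s\<close> vanishes at 0 because
  \<open>h\<close> is bounded there and Re s > 0, and at infinity by exponential decay.\<close>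

lemma mellin_deriv:
  assumes h: "exp_decay h" and h': "exp_decay h'"
    and deriv: "\<And>t. t > 0 \<Longrightarrow> (h has_vector_derivative h' t) (at t)"
    and s: "Re s > 0"
  shows "s * mellin h s = - mellin h' (s + 1)"
proof -
  from h obtain C c where C: "C > 0" "c > 0" "\<And>t. t > 0 \<Longrightarrow> norm (h t) \<le> C * exp (- c * t)"
    by (auto elim: exp_decayE)
  define F where "F = (\<lambda>t. h t * complex_of_real t powr s)"
  define f where "f = (\<lambda>t. h' t * complex_of_real t powr s + s * (h t * complex_of_real t powr (s - 1)))"
  have i1: "set_integrable lborel {0<..} (\<lambda>t. h' t * complex_of_real t powr s)"
    using set_integrable_mellin[OF h', of "s + 1"] s by simp
  have i2: "set_integrable lborel {0<..} (\<lambda>t. s * (h t * complex_of_real t powr (s - 1)))"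
    using set_integrable_mellin[OF h s] by (intro set_integrable_mult_right) auto
  have bound: "norm (F t) \<le> C * (t powr Re s * exp (- c * t))" if "t > 0" for t
  proof -
    have "norm (F t) \<le> (C * exp (- c * t)) * t powr Re s"
      unfolding F_def norm_mult norm_powr_of_real[OF that]
      by (intro mult_right_mono C that) auto
    thus ?thesis by (simp add: mult_ac)
  qed
  have "(LBINT t=0..\<infinity>. f t) = 0 - 0"
  proof (rule interval_integral_FTC_integrable)
    fix t :: real assume "0 < ereal t"
    hence t: "t > 0" by simp
    have "((\<lambda>t. complex_of_real t powr s) has_vector_derivative (s * of_real t powr (s - 1))) (at t)"
      using t by (intro has_vector_derivative_real_field) (auto intro!: derivative_eq_intros)
    from has_vector_derivative_mult[OF deriv[OF t] this]
    show "(F has_vector_derivative f t) (at t)"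
      by (simp add: F_def f_def algebra_simps)
    have "continuous_on {0<..} h" "continuous_on {0<..} h'"
      using h h' by (auto simp: exp_decay_def)
    hence "continuous_on {0<..} f"
      unfolding f_def by (intro continuous_intros) auto
    thus "isCont f t"
      using t by (simp add: continuous_on_eq_continuous_at)
  next
    show "set_integrable lborel (einterval 0 \<infinity>) f"
      using set_integral_add(1)[OF i1 i2] by (simp add: f_def einterval_def greaterThan_def)
    have "((\<lambda>t. C * (t powr Re s * exp (- c * t))) \<longlongrightarrow> 0) (at_right 0)"
      using s C by real_asymp
    hence "(F \<longlongrightarrow> 0) (at_right 0)"
      by (rule Lim_null_comparison[rotated])
         (rule eventually_mono[OF eventually_at_right_less[of 0]], rule bound)
    thus "((F \<circ> real_of_ereal) \<longlongrightarrow> 0) (at_right 0)"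
      using ereal_tendsto_simps1(2)[of F 0 0] by (simp add: zero_ereal_def)
    have "((\<lambda>t. C * (t powr Re s * exp (- c * t))) \<longlongrightarrow> 0) at_top"
      using C by real_asymp
    hence "(F \<longlongrightarrow> 0) at_top"
      by (rule Lim_null_comparison[rotated]) 
         (rule eventually_mono[OF eventually_gt_at_top[of 0]], rule bound)
    thus "((F \<circ> real_of_ereal) \<longlongrightarrow> 0) (at_left \<infinity>)"
      by (simp add: ereal_tendsto_simps1)
  qed auto
  hence "(LINT t:{0<..}|lborel. f t) = 0"
    by (simp add: zero_ereal_def interval_integral_to_infinity_eq)
  hence "mellin h' (s + 1) + s * mellin h s = 0"
    using set_integral_add(2)[OF i1 i2] by (simp add: f_def mellin_def)
  thus ?thesis by (simp add: eq_neg_iff_add_eq_0 add.commute)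
qed

text \<open>Euler's integral for Gamma after substituting c * t for t.\<close>

lemma mellin_exp:
  assumes "c > 0" "Re s > 0"
  shows "mellin (\<lambda>t. of_real (exp (- c * t))) s = Gamma s * of_real c powr (- s)"
proof -
  define f where "f = (\<lambda>t. indicator {0<..} t *\<^sub>R (complex_of_real t powr (s - 1) / of_real (exp t)))"
  have meas: "f \<in> borel_measurable borel"
    unfolding f_def
    by (intro borel_measurable_continuous_on_indicator continuous_intros) auto
  have "integrable lebesgue f"
    using absolutely_integrable_Gamma_integral'[of s] assms by (simp add: set_integrable_def f_def)
  hence int: "integrable lborel f"
    using meas by (simp add: integrable_completion)
  have "set_lebesgue_integral lborel {0<..} (\<lambda>t. complex_of_real t powr (s - 1) / of_real (exp t))
         = integral {0<..} (\<lambda>t. complex_of_real t powr (s - 1) / of_real (exp t))"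
    by (rule set_borel_integral_eq_integral(2)) (use int in \<open>simp add: set_integrable_def f_def\<close>)
  also have "\<dots> = Gamma s"
    using Gamma_integral_complex'[OF assms(2)] by (rule integral_unique)
  finally have "Gamma s = (LINT t|lborel. f t)"
    by (simp add: set_lebesgue_integral_def f_def)
  also have "\<dots> = \<bar>c\<bar> *\<^sub>R (LINT t|lborel. f (0 + c * t))"
    using assms by (intro lborel_integral_real_affine) auto
  also have "(LINT t|lborel. f (0 + c * t)) =
               (LINT t|lborel. of_real c powr (s - 1) * (indicator {0<..} t *\<^sub>R
                  (of_real (exp (- c * t)) * complex_of_real t powr (s - 1))))"
    using assms
    by (intro Bochner_Integration.integral_cong)
       (auto simp: f_def indicator_def zero_less_mult_iff powr_times_real exp_minus field_simps)
  also have "\<dots> = of_real c powr (s - 1) * mellin (\<lambda>t. of_real (exp (- c * t))) s"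
    unfolding mellin_def set_lebesgue_integral_def by (rule integral_mult_right_zero)
  finally have "Gamma s = of_real c * of_real c powr (s - 1) * mellin (\<lambda>t. of_real (exp (- c * t))) s"
    using assms by (simp add: scaleR_conv_of_real)
  also have "of_real c * of_real c powr (s - 1) = of_real c powr s"
    using assms by (simp add: powr_diff)
  finally show ?thesis
    using assms by (simp add: powr_minus field_simps)
qed

text \<open>Dominated convergence applied to the partial sums; continuity of \<open>H\<close>
  supplies measurability of the limit. Bounding the partial sums as a whole lets them be compared
  directly with the generating function.\<close>

lemma mellin_sums:
  assumes h: "\<And>k. exp_decay (h k)" and g: "exp_decay g" and s: "Re s > 0"
    and sums: "\<And>t. t > 0 \<Longrightarrow> (\<lambda>k. h k t) sums H t"
    and bound: "\<And>t n. t > 0 \<Longrightarrow> norm (\<Sum>k<n. h k t) \<le> norm (g t)"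
    and contH: "continuous_on {0<..} H"
  shows "(\<lambda>k. mellin (h k) s) sums mellin H s"
proof -
  define P where "P = (\<lambda>n t. indicator {0<..} t *\<^sub>R ((\<Sum>k<n. h k t) * complex_of_real t powr (s - 1)))"
  have "(\<Sum>k<n. mellin (h k) s) = (LINT t|lborel. P n t)" for n
  proof -
    have "(LINT t|lborel. P n t) =
            (LINT t|lborel. (\<Sum>k<n. indicator {0<..} t *\<^sub>R (h k t * complex_of_real t powr (s - 1))))"
      by (simp add: P_def sum_distrib_right scaleR_sum_right)
    also have "\<dots> = (\<Sum>k<n. mellin (h k) s)"
      unfolding mellin_def set_lebesgue_integral_def
      by (rule Bochner_Integration.integral_sum)
         (use set_integrable_mellin[OF h s] in \<open>simp add: set_integrable_def\<close>)
    finally show ?thesis by simp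
  qed
  moreover have "(\<lambda>n. LINT t|lborel. P n t) \<longlonglongrightarrow> mellin H s"
    unfolding mellin_def set_lebesgue_integral_def
  proof (rule integral_dominated_convergence)
    show "integrable lborel (\<lambda>t. norm (indicator {0<..} t *\<^sub>R (g t * complex_of_real t powr (s - 1))))"
      using set_integrable_mellin[OF g s] by (intro integrable_norm) (simp add: set_integrable_def)
    show "(\<lambda>t. indicator {0<..} t *\<^sub>R (H t * complex_of_real t powr (s - 1))) \<in> borel_measurable lborel"
      using set_borel_measurable_mellin[OF contH] by simp
    have "continuous_on {0<..} (\<lambda>t. \<Sum>k<n. h k t)" for n
      using h by (intro continuous_intros) (auto simp: exp_decay_def)
    thus "P n \<in> borel_measurable lborel" for n
      unfolding P_def using set_borel_measurable_mellin by simp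
    have "(\<lambda>n. P n t) \<longlonglongrightarrow> indicator {0<..} t *\<^sub>R (H t * complex_of_real t powr (s - 1))" for t
      using sums[of t] unfolding P_def sums_def
      by (cases "t > 0") (auto intro!: tendsto_intros)
    thus "AE t in lborel. (\<lambda>n. P n t) \<longlonglongrightarrow> indicator {0<..} t *\<^sub>R (H t * complex_of_real t powr (s - 1))"
      by simp
    show "AE t in lborel. norm (P n t) \<le> norm (indicator {0<..} t *\<^sub>R (g t * complex_of_real t powr (s - 1)))" for n
      using bound by (intro AE_I2) (auto simp: P_def indicator_def norm_mult intro!: mult_right_mono)
  qed
  ultimately show ?thesis by (simp add: sums_def)
qed

lemma mellin_sum:
  assumes h: "\<And>k. k \<in> A \<Longrightarrow> exp_decay (h k)" and s: "Re s > 0"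
  shows "mellin (\<lambda>t. \<Sum>k\<in>A. c k * h k t) s = (\<Sum>k\<in>A. c k * mellin (h k) s)"
proof -
  have int: "set_integrable lborel {0<..} (\<lambda>t. c k * (h k t * of_real t powr (s - 1)))" if "k \<in> A" for k
    using set_integrable_mellin[OF h[OF that] s] by (rule set_integrable_mult_right)
  have "mellin (\<lambda>t. \<Sum>k\<in>A. c k * h k t) s =
          (LINT t|lborel. (\<Sum>k\<in>A. indicator {0<..} t *\<^sub>R (c k * (h k t * of_real t powr (s - 1)))))"
    by (simp add: mellin_def set_lebesgue_integral_def sum_distrib_right scaleR_sum_right mult.assoc)
  also have "\<dots> = (\<Sum>k\<in>A. LINT t:{0<..}|lborel. c k * (h k t * of_real t powr (s - 1)))"
    unfolding set_lebesgue_integral_def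
    by (rule Bochner_Integration.integral_sum) (use int in \<open>simp add: set_integrable_def\<close>)
  also have "\<dots> = (\<Sum>k\<in>A. c k * mellin (h k) s)"
    unfolding mellin_def by (simp only: set_integral_mult_right)
  finally show ?thesis .
qed

lemma exp_decay_exp: "c > 0 \<Longrightarrow> exp_decay (\<lambda>t. of_real (exp (- c * t)))"
  by (rule exp_decayI[where C = 1 and c = c]) (auto intro!: continuous_intros)

section \<open>Derivatives of holomorphic functions along the positive real axis\<close>

text \<open>Cauchy's inequality on the unit circle around t; there Re z >= t - 1, which costs only a
  factor exp c.\<close>

lemma exp_decay_higher_deriv:
  assumes hol: "f holomorphic_on S" and S: "open S"
    and sub: "\<And>t::real. t \<ge> 0 \<Longrightarrow> cball (of_real t) 1 \<subseteq> S"
    and bound: "\<And>t z. t \<ge> 0 \<Longrightarrow> z \<in> cball (of_real t) 1 \<Longrightarrow> norm (f z) \<le> C * exp (- c * Re z)" and c: "c > 0"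
  shows "exp_decay (\<lambda>t. (deriv ^^ k) f (of_real t))"
proof (rule exp_decayI[OF _ c])
  have holk: "(deriv ^^ k) f holomorphic_on S"
    using holomorphic_higher_deriv[OF hol S] .
  have "of_real ` {0<..} \<subseteq> S"
  proof
    fix z assume "z \<in> complex_of_real ` {0<..}"
    then obtain t where "z = of_real t" "t > 0" by auto
    thus "z \<in> S" using sub[of t] by (auto simp: subset_iff)
  qed
  hence "continuous_on (of_real ` {0<..}) ((deriv ^^ k) f)"
    using holk holomorphic_on_imp_continuous_on holomorphic_on_subset by blast
  thus "continuous_on {0<..} (\<lambda>t. (deriv ^^ k) f (complex_of_real t))"
    by (intro continuous_on_compose2[of "of_real ` {0<..}" "(deriv ^^ k) f" "{0<..}" of_real] continuous_intros) auto
  fix t :: real assume t: "t > 0"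
  have "norm ((deriv ^^ k) f (of_real t)) \<le> fact k * (\<bar>C\<bar> * exp (- c * (t - 1))) / 1 ^ k"
  proof (rule Cauchy_inequality)
    show "f holomorphic_on ball (complex_of_real t) 1"
      using hol sub[of t] t holomorphic_on_subset by (metis ball_subset_cball less_imp_le subset_trans)
    show "continuous_on (cball (complex_of_real t) 1) f"
      using hol sub[of t] t by (meson holomorphic_on_imp_continuous_on holomorphic_on_subset less_imp_le)
    fix z assume z: "norm (complex_of_real t - z) = 1"
    have "\<bar>Re (complex_of_real t - z)\<bar> \<le> 1"
      using abs_Re_le_cmod z by metis
    hence "t - 1 \<le> Re z" by simp
    have "norm (f z) \<le> C * exp (- c * Re z)"
      by (rule bound[of t]) (use t z in \<open>auto simp: dist_norm\<close>)
    also have "\<dots> \<le> \<bar>C\<bar> * exp (- c * (t - 1))"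
      using \<open>t - 1 \<le> Re z\<close> c by (intro mult_mono) auto
    finally show "norm (f z) \<le> \<bar>C\<bar> * exp (- c * (t - 1))" .
  qed auto
  also have "fact k * (\<bar>C\<bar> * exp (- c * (t - 1))) / 1 ^ k = (fact k * \<bar>C\<bar> * exp c) * exp (- c * t)"
    by (simp add: exp_add[symmetric] algebra_simps)
  finally show "norm ((deriv ^^ k) f (of_real t)) \<le> (fact k * \<bar>C\<bar> * exp c) * exp (- c * t)" .
qed

lemma has_vector_derivative_higher_deriv:
  assumes "f holomorphic_on S" "open S" "complex_of_real t \<in> S"
  shows "((\<lambda>t. (deriv ^^ k) f (of_real t)) has_vector_derivative (deriv ^^ Suc k) f (of_real t)) (at t)"
proof (rule has_vector_derivative_real_field)
  have "(deriv ^^ k) f holomorphic_on S"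
    using holomorphic_higher_deriv assms by blast
  thus "((deriv ^^ k) f has_field_derivative (deriv ^^ Suc k) f (of_real t)) (at (of_real t))"
    using assms holomorphic_derivI[of "(deriv ^^ k) f" S] by auto
qed

section \<open>The generating function and the analytic continuation\<close>

text \<open>The sides are below \<open>2\<pi>\<close>, so \<open>exp z = 1\<close> only at \<open>z = 0\<close> inside, and large enough
  for unit discs around the nonnegative reals, to which Cauchy's inequality is applied.\<close>

definition strip :: "complex set" where
  "strip = {z. Re z > -2 \<and> \<bar>Im z\<bar> < 2}"

text \<open>For nonzero z this is z exp ((1 - a) z) / (exp z - 1), the generating function of the
  Bernoulli polynomials at 1 - a. Dividing by the continuous extension of (exp z - 1) / z removes
  the singularity at 0.\<close>

definition hurwitz_gen :: "real \<Rightarrow> complex \<Rightarrow> complex" where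
  "hurwitz_gen a z = exp ((1 - of_real a) * z) / (if z = 0 then 1 else (exp z - 1) / z)"

lemma open_strip: "open strip"
proof -
  have "strip = {z. Re z > -2} \<inter> {z. Im z < 2} \<inter> {z. Im z > -2}"
    by (auto simp: strip_def)
  moreover have "open \<dots>"
    by (intro open_Int open_halfspace_Re_gt open_halfspace_Im_gt open_halfspace_Im_lt)
  ultimately show ?thesis by simp
qed

lemma zero_in_strip: "0 \<in> strip"
  by (simp add: strip_def)

lemma cball_subset_strip: "t \<ge> 0 \<Longrightarrow> cball (of_real t) 1 \<subseteq> strip"
proof
  fix z assume "t \<ge> 0" "z \<in> cball (complex_of_real t) 1"
  thus "z \<in> strip"
    using abs_Re_le_cmod[of "complex_of_real t - z"] abs_Im_le_cmod[of "complex_of_real t - z"]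
    by (auto simp: strip_def dist_norm)
qed

lemma strip_exp_neq_1:
  assumes "z \<in> strip" "z \<noteq> 0"
  shows "exp z \<noteq> 1"
proof
  assume "exp z = 1"
  then obtain n :: int where n: "Re z = 0" "Im z = of_int (2 * n) * pi"
    by (auto simp: exp_eq_1)
  hence "\<bar>real_of_int n\<bar> * (2 * pi) < 2"
    using assms by (simp add: strip_def abs_mult mult_ac)
  moreover have "n \<noteq> 0"
    using n assms complex_eq_iff by auto
  hence "\<bar>real_of_int n\<bar> * (2 * pi) \<ge> 1 * (2 * pi)"
    by (intro mult_right_mono) auto
  ultimately show False using pi_gt3 by linarith
qed

text \<open>The denominator is the difference quotient of exp at 0, completed by the derivative 1,
  hence holomorphic by \<open>pole_lemma\<close>. It has no zeros because 0 is the only solution of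
  exp z = 1 in \<open>strip\<close>.\<close>

lemma holomorphic_hurwitz_gen: "hurwitz_gen a holomorphic_on strip"
proof -
  have "(\<lambda>z::complex. if z = 0 then deriv exp 0 else (exp z - exp 0) / (z - 0)) holomorphic_on strip"
    by (rule pole_lemma) (auto simp: interior_open[OF open_strip] holomorphic_on_exp zero_in_strip)
  hence "(\<lambda>z::complex. if z = 0 then 1 else (exp z - 1) / z) holomorphic_on strip"
    using DERIV_imp_deriv[OF DERIV_exp[of "0::complex"]] by (simp cong: if_cong)
  thus ?thesis
    unfolding hurwitz_gen_def[abs_def]
    by (intro holomorphic_on_divide) (auto intro!: holomorphic_intros simp: strip_exp_neq_1)
qed

lemma hurwitz_gen_of_real:
  assumes "t > 0"
  shows "hurwitz_gen a (of_real t) = of_real (t * exp ((1 - a) * t) / (exp t - 1))"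
proof -
  have "complex_of_real (exp t) \<noteq> 1" using assms by (metis exp_eq_one_iff of_real_eq_1_iff less_irrefl)
  thus ?thesis using assms
    by (simp add: hurwitz_gen_def flip: exp_of_real)
qed

text \<open>For large Re z the modulus behaves like norm z * exp (- a Re z), and half of the rate a
  is given up to absorb norm z. The part with Re z <= 1 is compact.\<close>

lemma hurwitz_gen_bound:
  assumes a: "0 < a" "a \<le> 1"
  obtains C where "\<And>z. Re z \<ge> -1 \<Longrightarrow> \<bar>Im z\<bar> \<le> 1 \<Longrightarrow> norm (hurwitz_gen a z) \<le> C * exp (- (a / 2) * Re z)"
proof -
  define K where "K = cbox (Complex (-1) (-1)) (Complex 1 1)"
  have K: "z \<in> K \<longleftrightarrow> -1 \<le> Re z \<and> Re z \<le> 1 \<and> -1 \<le> Im z \<and> Im z \<le> 1" for z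
    by (auto simp: K_def in_cbox_complex_iff)
  have "K \<subseteq> strip" by (auto simp: K strip_def)
  hence "continuous_on K (hurwitz_gen a)"
    using holomorphic_hurwitz_gen holomorphic_on_imp_continuous_on holomorphic_on_subset by blast
  moreover have "compact K" by (simp add: K_def)
  ultimately have "bounded (hurwitz_gen a ` K)"
    by (intro compact_imp_bounded compact_continuous_image)
  then obtain B where B: "B > 0" "\<And>z. z \<in> K \<Longrightarrow> norm (hurwitz_gen a z) \<le> B"
    by (auto simp: bounded_pos)
  \<comment> \<open>For x = Re z > 1, the numerator bounds norm z / exp (a x / 2), and the
    denominator bounds (exp x - 1) / exp x from below.\<close>
  define D where "D = (2 / a + 1) / (1 - exp (-1))"
  have e1: "exp (-1) < (1::real)" by simp
  have D: "D > 0" unfolding D_def using a e1 by (intro divide_pos_pos add_nonneg_pos) auto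
  \<comment> \<open>The factor exp (a / 2) makes up for exp (- (a / 2) * Re z), which is at least
    exp (- a / 2) when Re z <= 1.\<close>
  define C where "C = max (B * exp (a / 2)) D"
  show thesis
  proof (rule that[of C])
    fix z :: complex assume z: "Re z \<ge> -1" "\<bar>Im z\<bar> \<le> 1"
    show "norm (hurwitz_gen a z) \<le> C * exp (- (a / 2) * Re z)"
    proof (cases "Re z \<le> 1")
      case True
      have "norm (hurwitz_gen a z) \<le> B * 1"
        using B(2)[of z] True z by (simp add: K abs_le_iff)
      also have "1 \<le> exp (a / 2) * exp (- (a / 2) * Re z)"
      proof -
        have "a * Re z \<le> a * 1" using True a by (intro mult_left_mono) auto
        thus ?thesis by (simp add: exp_add[symmetric])
      qed
      hence "B * 1 \<le> B * (exp (a / 2) * exp (- (a / 2) * Re z))"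
        using B by (intro mult_left_mono) auto
      also have "\<dots> \<le> C * exp (- (a / 2) * Re z)"
        unfolding mult.assoc[symmetric] by (intro mult_right_mono) (auto simp: C_def)
      finally show ?thesis .
    next
      case False
      define x where "x = Re z"
      have x: "x > 1" using False by (simp add: x_def)
      have "norm (exp z - 1) \<ge> norm (exp z) - norm (1::complex)"
        by (rule norm_triangle_ineq2)
      hence "norm (exp z - 1) \<ge> exp x - 1" by (simp add: x_def)
      moreover have "exp x * exp (-1) \<ge> 1"
        using x by (simp add: exp_add[symmetric])
      ultimately have den: "norm (exp z - 1) \<ge> exp x * (1 - exp (-1))"
        by (simp add: algebra_simps)
      have "x * (a / 2) \<le> exp (a / 2 * x)" using exp_ge_add_one_self[of "a / 2 * x"] by (simp only: mult.commute)
      hence "x \<le> 2 / a * exp (a / 2 * x)" using a by (simp add: field_simps)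
      moreover have "1 \<le> exp (a / 2 * x)" using a x by simp
      moreover have "norm z \<le> x + 1" using cmod_le[of z] z x by (simp add: x_def)
      ultimately have num: "norm z \<le> (2 / a + 1) * exp (a / 2 * x)"
        unfolding distrib_right by linarith
      have "z \<noteq> 0" using False by auto
      hence "norm (hurwitz_gen a z) = exp ((1 - a) * x) * norm z / norm (exp z - 1)"
        by (simp add: hurwitz_gen_def norm_mult norm_divide x_def)
      also have "\<dots> \<le> exp ((1 - a) * x) * ((2 / a + 1) * exp (a / 2 * x)) / (exp x * (1 - exp (-1)))"
        using num den e1 a by (intro frac_le mult_left_mono) auto
      also have "\<dots> = D * (exp ((1 - a) * x) * exp (a / 2 * x) / exp x)"
        by (simp add: D_def mult_ac)
      also have "exp ((1 - a) * x) * exp (a / 2 * x) / exp x = exp (- (a / 2) * x)"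
        by (simp add: exp_add[symmetric] exp_diff[symmetric] algebra_simps)
      also have "D * exp (- (a / 2) * x) \<le> C * exp (- (a / 2) * x)"
        by (intro mult_right_mono) (auto simp: C_def)
      finally show ?thesis by (simp add: x_def)
    qed
  qed
qed

definition hurwitz_gen_deriv :: "real \<Rightarrow> nat \<Rightarrow> real \<Rightarrow> complex" where
  "hurwitz_gen_deriv a k t = (deriv ^^ k) (hurwitz_gen a) (of_real t)"

lemma exp_decay_hurwitz_gen_deriv:
  assumes "0 < a" "a \<le> 1"
  shows "exp_decay (hurwitz_gen_deriv a k)"
proof -
  obtain C where C: "\<And>z. Re z \<ge> -1 \<Longrightarrow> \<bar>Im z\<bar> \<le> 1 \<Longrightarrow> norm (hurwitz_gen a z) \<le> C * exp (- (a / 2) * Re z)"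
    using hurwitz_gen_bound[OF assms] by blast
  show ?thesis
    unfolding hurwitz_gen_deriv_def[abs_def]
  proof (rule exp_decay_higher_deriv[OF holomorphic_hurwitz_gen open_strip cball_subset_strip])
    fix t :: real and z assume "t \<ge> 0" "z \<in> cball (complex_of_real t) 1"
    thus "norm (hurwitz_gen a z) \<le> C * exp (- (a / 2) * Re z)"
      using abs_Re_le_cmod[of "complex_of_real t - z"] abs_Im_le_cmod[of "complex_of_real t - z"]
      by (intro C) (auto simp: dist_norm)
  qed (use assms in auto)
qed

lemma hurwitz_gen_deriv_has_vector_derivative:
  "t > 0 \<Longrightarrow> (hurwitz_gen_deriv a k has_vector_derivative hurwitz_gen_deriv a (Suc k) t) (at t)"
  unfolding hurwitz_gen_deriv_def[abs_def]
  by (rule has_vector_derivative_higher_deriv[OF holomorphic_hurwitz_gen open_strip]) (simp add: strip_def)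

section \<open>Gluing the half-planes into an entire function\<close>

text \<open>On \<open>Re s > 1 - k\<close> this is \<open>(s - 1) \<zeta>(s, a)\<close> after \<open>k\<close> integrations by parts.\<close>

definition zeta_piece :: "real \<Rightarrow> nat \<Rightarrow> complex \<Rightarrow> complex" where
  "zeta_piece a k s = (-1) ^ k * rGamma (s - 1 + of_nat k) * mellin (hurwitz_gen_deriv a k) (s - 1 + of_nat k)"

text \<open>One integration by parts raises the argument by 1 and changes the sign; the factor w
  that it produces is absorbed by rGamma w = w * rGamma (w + 1).\<close>

lemma zeta_piece_Suc:
  assumes "0 < a" "a \<le> 1" "Re s > 1 - real k"
  shows "zeta_piece a (Suc k) s = zeta_piece a k s"
proof -
  define w where "w = s - 1 + of_nat k"
  have "Re w > 0" using assms by (simp add: w_def)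
  hence "w * mellin (hurwitz_gen_deriv a k) w = - mellin (hurwitz_gen_deriv a (Suc k)) (w + 1)"
    by (intro mellin_deriv exp_decay_hurwitz_gen_deriv hurwitz_gen_deriv_has_vector_derivative assms)
  moreover have "rGamma w = w * rGamma (w + 1)" by (simp add: rGamma_plus1)
  moreover have "s - 1 + of_nat (Suc k) = w + 1" by (simp add: w_def)
  ultimately show ?thesis
    unfolding zeta_piece_def w_def[symmetric] by (simp add: mult.assoc mult.left_commute[of w])
qed

lemma zeta_piece_eq:
  assumes "0 < a" "a \<le> 1" "Re s > 1 - real k" "k \<le> n"
  shows "zeta_piece a n s = zeta_piece a k s"
  using \<open>k \<le> n\<close>
proof (induction n rule: dec_induct)
  case (step n)
  thus ?case using zeta_piece_Suc[of a n s] assms by simp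
qed simp

text \<open>The index k is chosen so that Re s > 1 - k; for 0 < a <= 1 every other such k gives the
  same value.\<close>

definition zeta_entire :: "real \<Rightarrow> complex \<Rightarrow> complex" where
  "zeta_entire a s = zeta_piece a (nat \<lceil>2 - Re s\<rceil>) s"

lemma zeta_entire_eq:
  assumes "0 < a" "a \<le> 1" "Re s > 1 - real k"
  shows "zeta_entire a s = zeta_piece a k s"
proof -
  define m where "m = nat \<lceil>2 - Re s\<rceil>"
  have m: "Re s > 1 - real m" unfolding m_def by linarith
  \<comment> \<open>\<open>zeta_piece_eq\<close> compares an index with a larger one, so both
    indices are compared with their maximum.\<close>
  have "zeta_piece a m s = zeta_piece a (max m k) s"
    by (rule zeta_piece_eq[symmetric]) (use assms m in auto)
  also have "\<dots> = zeta_piece a k s"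
    by (rule zeta_piece_eq) (use assms in auto)
  finally show ?thesis by (simp add: zeta_entire_def m_def)
qed

text \<open>On each half-plane Re s > 1 - k the function is the single piece k, up to sign a product
  of the entire function rGamma and a Mellin transform, both shifted. These half-planes cover the
  plane.\<close>

lemma holomorphic_zeta_entire:
  assumes "0 < a" "a \<le> 1"
  shows "zeta_entire a holomorphic_on UNIV"
proof -
  define A where "A = (\<lambda>k::nat. {s. Re s > 1 - real k})"
  have "zeta_entire a holomorphic_on (\<Union>k. A k)"
  proof (rule holomorphic_on_UN_open)
    fix k :: nat
    show "open (A k)" by (simp add: A_def open_halfspace_Re_gt)
    have "zeta_piece a k holomorphic_on A k"
      unfolding zeta_piece_def[abs_def]
      by (intro holomorphic_intros holomorphic_on_compose_gen[OF _ holomorphic_mellin, unfolded o_def]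
            exp_decay_hurwitz_gen_deriv assms) (auto simp: A_def)
    thus "zeta_entire a holomorphic_on A k"
      by (rule holomorphic_transform) (use zeta_entire_eq assms in \<open>auto simp: A_def\<close>)
  qed
  also have "(\<Union>k. A k) = UNIV"
  proof -
    have "s \<in> A (nat \<lceil>2 - Re s\<rceil>)" for s
      unfolding A_def by (simp) linarith
    thus ?thesis by blast
  qed
  finally show ?thesis .
qed

section \<open>Comparison with the Dirichlet series and with \<open>hurwitz_zeta\<close>\<close>

text \<open>Expanding 1 / (1 - exp (- t)) geometrically and integrating termwise yields Gamma s
  times the Dirichlet series; rGamma (s - 1) = (s - 1) * rGamma s accounts for the division by s -
  1.\<close>

lemma zeta_entire_sums:
  assumes a: "0 < a" "a \<le> 1" and s: "Re s > 1"
  shows "(\<lambda>n. complex_of_real (real n + a) powr (- s)) sums (zeta_entire a s / (s - 1))"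
proof -
  \<comment> \<open>The factor \<open>t\<close> is taken out of \<open>t powr (s - 1)\<close>, as without it the sum is unbounded at 0.\<close>
  define h where "h = (\<lambda>n t. complex_of_real (t * exp (- (real n + a) * t)))"
  have h_sums: "(\<lambda>n. h n t) sums hurwitz_gen_deriv a 0 t" if "t > 0" for t
  proof -
    have "(\<lambda>n. (t * exp (- a * t)) * exp (- t) ^ n) sums ((t * exp (- a * t)) * (1 / (1 - exp (- t))))"
      using that by (intro sums_mult geometric_sums) auto
    also have "(\<lambda>n. (t * exp (- a * t)) * exp (- t) ^ n) = (\<lambda>n. t * exp (- (real n + a) * t))"
      by (simp add: exp_of_nat_mult[symmetric] exp_add[symmetric] algebra_simps)
    also have "t * exp (- a * t) * (1 / (1 - exp (- t))) = t * exp ((1 - a) * t) / (exp t - 1)"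
      using that by (simp add: exp_minus left_diff_distrib exp_diff field_simps)
    finally show ?thesis
      using that by (simp add: h_def sums_of_real_iff hurwitz_gen_deriv_def hurwitz_gen_of_real del: of_real_mult of_real_divide)
  qed
  have h_nonneg: "h n t = of_real (t * exp (- (real n + a) * t))" for n t
    by (simp add: h_def)
  have decay: "exp_decay (h n)" for n
  proof -
    define c where "c = real n + a"
    have c: "c > 0" using a by (simp add: c_def)
    show ?thesis
    proof (rule exp_decayI)
      show "continuous_on {0<..} (h n)" unfolding h_def by (intro continuous_intros)
      show "c / 2 > 0" using c by simp
      fix t :: real assume t: "t > 0"
      \<comment> \<open>Half of the rate c is spent on absorbing the factor t, by exp y >= y with y
        = c t / 2.\<close>
      have "t * (c / 2) \<le> exp (c / 2 * t)" using exp_ge_add_one_self[of "c / 2 * t"] by (simp only: mult.commute)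
      hence "t \<le> exp (c / 2 * t) / (c / 2)" using c by (subst pos_le_divide_eq) auto
      also have "\<dots> = 2 / c * exp (c / 2 * t)" by simp
      finally have "t \<le> 2 / c * exp (c / 2 * t)" .
      hence "t * exp (- c * t) \<le> 2 / c * exp (c / 2 * t) * exp (- c * t)"
        by (intro mult_right_mono) auto
      also have "\<dots> = 2 / c * exp (- (c / 2) * t)"
        by (simp add: exp_add[symmetric])
      finally show "norm (h n t) \<le> 2 / c * exp (- (c / 2) * t)"
        using t by (simp add: h_nonneg c_def norm_mult)
    qed
  qed
  \<comment> \<open>All terms are nonnegative, so the partial sums stay below their limit and the
    generating function is its own majorant.\<close>
  have partial: "norm (\<Sum>k<n. h k t) \<le> norm (hurwitz_gen_deriv a 0 t)" if "t > 0" for n t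
  proof -
    define r where "r = (\<lambda>k. t * exp (- (real k + a) * t))"
    define g where "g = t * exp ((1 - a) * t) / (exp t - 1)"
    have "r sums g"
      using h_sums[OF that] that
      by (simp add: h_nonneg r_def g_def hurwitz_gen_deriv_def hurwitz_gen_of_real sums_of_real_iff del: of_real_mult of_real_divide)
    hence "(\<Sum>k<n. r k) \<le> g"
      using that sum_le_suminf[of r "{..<n}"]
      by (auto simp: r_def sums_iff)
    moreover have "(\<Sum>k<n. r k) \<ge> 0" using that by (auto simp: r_def intro!: sum_nonneg)
    moreover have "(\<Sum>k<n. h k t) = of_real (\<Sum>k<n. r k)" by (simp add: h_nonneg r_def)
    moreover have "hurwitz_gen_deriv a 0 t = of_real g" using that by (simp add: hurwitz_gen_deriv_def hurwitz_gen_of_real g_def)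
    ultimately show ?thesis by (simp del: of_real_sum)
  qed
  \<comment> \<open>The factor t raises the exponent s - 2 to s - 1, which turns the transform at s
    - 1 into one at s.\<close>
  have mellin_h: "mellin (h n) (s - 1) = Gamma s * of_real (real n + a) powr (- s)" for n
  proof -
    have "mellin (h n) (s - 1) = mellin (\<lambda>t. of_real (exp (- (real n + a) * t))) s"
      unfolding mellin_def h_nonneg
      by (intro set_lebesgue_integral_cong) (auto simp: powr_diff field_simps power2_eq_square)
    also have "\<dots> = Gamma s * of_real (real n + a) powr (- s)"
      using a s by (intro mellin_exp) auto
    finally show ?thesis .
  qed
  have "(\<lambda>n. mellin (h n) (s - 1)) sums mellin (hurwitz_gen_deriv a 0) (s - 1)"
    using s exp_decay_hurwitz_gen_deriv[OF a, of 0]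
    by (intro mellin_sums[where g = "hurwitz_gen_deriv a 0"] decay h_sums partial) (auto simp: exp_decay_def)
  hence "(\<lambda>n. rGamma s * (Gamma s * of_real (real n + a) powr (- s))) sums (rGamma s * mellin (hurwitz_gen_deriv a 0) (s - 1))"
    unfolding mellin_h by (rule sums_mult)
  \<comment> \<open>In HOL, Gamma is 0 at the nonpositive integers and only there; Re s > 1 excludes
    them.\<close>
  moreover have "Gamma s \<noteq> 0"
    using s by (auto simp: Gamma_eq_zero_iff elim!: nonpos_Ints_cases)
  ultimately have "(\<lambda>n. of_real (real n + a) powr (- s)) sums (rGamma s * mellin (hurwitz_gen_deriv a 0) (s - 1))"
    by (simp add: rGamma_inverse_Gamma mult.assoc[symmetric])
  also have "rGamma s * mellin (hurwitz_gen_deriv a 0) (s - 1) = zeta_entire a s / (s - 1)"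
  proof -
    have "zeta_entire a s = rGamma (s - 1) * mellin (hurwitz_gen_deriv a 0) (s - 1)"
      using zeta_entire_eq[OF a, of 0 s] s by (simp add: zeta_piece_def)
    also have "rGamma (s - 1) = (s - 1) * rGamma s"
      using rGamma_plus1[of "s - 1"] by simp
    finally show ?thesis using s by auto
  qed
  finally show ?thesis .
qed

text \<open>Existence comes from \<open>zeta_entire\<close>. Uniqueness is the identity theorem on
  the punctured plane, which is connected, starting from the half-plane Re s > 1; the value at 1 is
  fixed by the definition.\<close>

lemma hurwitz_zeta_eq:
  assumes a: "0 < a" "a \<le> 1"
  shows "hurwitz_zeta a = (\<lambda>s. if s = 1 then 0 else zeta_entire a s / (s - 1))"
  unfolding hurwitz_zeta_def
proof (rule the_equality)
  let ?f = "\<lambda>s. if s = 1 then 0 else zeta_entire a s / (s - 1)"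
  have "zeta_entire a holomorphic_on (UNIV - {1})"
    using holomorphic_zeta_entire[OF a] holomorphic_on_subset by blast
  hence "(\<lambda>s. zeta_entire a s / (s - 1)) holomorphic_on (UNIV - {1})"
    by (intro holomorphic_intros) auto
  hence hol: "?f holomorphic_on (UNIV - {1})"
    by (rule holomorphic_transform) auto
  have series: "?f s = (\<Sum>n. complex_of_real (real n + a) powr (- s))" if "Re s > 1" for s
    using sums_unique[OF zeta_entire_sums[OF a that]] that by auto
  show "?f holomorphic_on (UNIV - {1}) \<and>
     (\<forall>s. Re s > 1 \<longrightarrow> ?f s = (\<Sum>n. complex_of_real (real n + a) powr (- s))) \<and> ?f 1 = 0"
    using hol series by simp
  fix f assume f: "f holomorphic_on (UNIV - {1}) \<and>
     (\<forall>s. Re s > 1 \<longrightarrow> f s = (\<Sum>n. complex_of_real (real n + a) powr (- s))) \<and> f 1 = 0"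
  have "f s = ?f s" if "s \<noteq> 1" for s
  proof (rule analytic_continuation_open[where s = "{s. Re s > 1}" and s' = "UNIV - {1}" and f = f and g = ?f])
    show "open {s. Re s > 1}" by (simp add: open_halfspace_Re_gt)
    show "{s. Re s > 1} \<noteq> {}" by (auto intro: exI[of _ 2])
    show "connected (UNIV - {1 :: complex})"
      using connected_punctured_universe[of "1 :: complex"] by (simp add: Compl_eq_Diff_UNIV)
    fix z :: complex assume "z \<in> {s. Re s > 1}"
    thus "f z = ?f z" using f series[of z] by simp
  qed (use f hol that in auto)
  thus "f = ?f" using f by auto
qed

text \<open>\<open>remove_sings\<close> takes a limit. In a punctured neighbourhood of every point,
  s = 1 included, the product agrees with \<open>zeta_entire a\<close>, which is continuous.\<close>

lemma hurwitz_zeta_entire_eq: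
  assumes a: "0 < a" "a \<le> 1"
  shows "hurwitz_zeta_entire a = zeta_entire a"
proof
  fix s
  have "isCont (zeta_entire a) s"
    using holomorphic_zeta_entire[OF a] holomorphic_on_imp_continuous_on
      continuous_on_eq_continuous_at by blast
  hence "(zeta_entire a \<longlongrightarrow> zeta_entire a s) (at s)"
    by (simp add: isCont_def)
  moreover have "eventually (\<lambda>w. (w - 1) * hurwitz_zeta a w = zeta_entire a w) (at s)"
    using eventually_neq_at_within[of 1 s UNIV]
    by eventually_elim (simp add: hurwitz_zeta_eq[OF a])
  ultimately have "((\<lambda>w. (w - 1) * hurwitz_zeta a w) \<longlongrightarrow> zeta_entire a s) (at s)"
    by (simp add: tendsto_cong)
  thus "hurwitz_zeta_entire a s = zeta_entire a s"
    unfolding hurwitz_zeta_entire_def by (rule remove_sings_eqI)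
qed

text \<open>The real quotient rule for the closed form on t > 0; uniqueness of derivatives links it
  to the complex derivative on the real axis.\<close>

lemma hurwitz_gen_deriv_1:
  assumes t: "t > 0"
  shows "hurwitz_gen_deriv a 1 t = - of_real (hurwitz_psi a t * exp (- (a - 1) * t))"
proof -
  have ne: "exp t - 1 \<noteq> 0" using t by simp
  have "((\<lambda>t. t * exp ((1 - a) * t) / (exp t - 1)) has_real_derivative
           - (hurwitz_psi a t * exp (- (a - 1) * t))) (at t)"
    using ne by (auto intro!: derivative_eq_intros simp: hurwitz_psi_def divide_simps) (simp add: algebra_simps power2_eq_square)
  hence "((\<lambda>t. complex_of_real (t * exp ((1 - a) * t) / (exp t - 1))) has_vector_derivative
           of_real (- (hurwitz_psi a t * exp (- (a - 1) * t)))) (at t)"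
    by (rule has_vector_derivative_of_real[unfolded has_real_derivative_iff_has_vector_derivative[symmetric]])
  hence "(hurwitz_gen_deriv a 0 has_vector_derivative
           of_real (- (hurwitz_psi a t * exp (- (a - 1) * t)))) (at t)"
    by (rule has_vector_derivative_transform_within_open[of _ _ _ "{0<..}"])
       (use t in \<open>auto simp: hurwitz_gen_deriv_def hurwitz_gen_of_real\<close>)
  from vector_derivative_unique_at[OF this hurwitz_gen_deriv_has_vector_derivative[OF t]]
  show ?thesis by simp
qed

section \<open>The series expansion\<close>

lemma binomial_exp:
  "exp (- a * t) * (1 - exp (- t)) ^ m = (\<Sum>k<Suc m. (-1) ^ k * real (m choose k) * exp (- (real k + a) * t))"
proof -
  have "(1 - exp (- t)) ^ m = (- exp (- t) + 1) ^ m" by simp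
  also have "\<dots> = (\<Sum>k\<le>m. real (m choose k) * (- exp (- t)) ^ k)"
    by (subst binomial_ring) simp
  also have "\<dots> = (\<Sum>k<Suc m. (-1) ^ k * real (m choose k) * exp (- (real k * t)))"
    by (simp add: lessThan_Suc_atMost power_minus[of "exp _"] exp_of_nat_mult[symmetric] mult_ac)
  finally show ?thesis
    by (simp add: sum_distrib_left exp_add[symmetric] algebra_simps mult_exp_exp del: sum.lessThan_Suc)
qed

text \<open>Each exponential in the binomial expansion has transform Gamma s * (k + a) powr (- s).
  The index is \<open>Suc m\<close> because the binomials in \<open>hurwitz_S n\<close> have upper
  entry n - 1.\<close>

lemma mellin_binomial_exp:
  assumes "a > 0" "Re s > 0"
  shows "mellin (\<lambda>t. of_real (exp (- a * t) * (1 - exp (- t)) ^ m)) s = Gamma s * hurwitz_S (Suc m) s a"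
proof -
  have "mellin (\<lambda>t. of_real (exp (- a * t) * (1 - exp (- t)) ^ m)) s =
          mellin (\<lambda>t. \<Sum>k<Suc m. ((-1) ^ k * of_nat (m choose k)) * of_real (exp (- (real k + a) * t))) s"
    unfolding binomial_exp by (simp del: sum.lessThan_Suc)
  also have "\<dots> = (\<Sum>k<Suc m. ((-1) ^ k * of_nat (m choose k)) * mellin (\<lambda>t. of_real (exp (- (real k + a) * t))) s)"
    using assms by (intro mellin_sum exp_decay_exp) auto
  also have "\<dots> = (\<Sum>k<Suc m. ((-1) ^ k * of_nat (m choose k)) * (Gamma s * of_real (real k + a) powr (- s)))"
    using assms by (intro sum.cong refl arg_cong2[where f = "(*)"] mellin_exp) auto
  also have "\<dots> = Gamma s * hurwitz_S (Suc m) s a"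
    by (simp add: hurwitz_S_def sum_distrib_left mult_ac del: sum.lessThan_Suc)
  finally show ?thesis .
qed

text \<open>Since 1 - u = exp (- t), the Mercator series of - ln (1 - u) sums to t; dividing by u
  lowers the powers by one.\<close>

lemma log_series_exp:
  fixes t :: real
  assumes "t > 0"
  defines "u \<equiv> 1 - exp (- t)"
  shows "(\<lambda>m. u ^ m / real (Suc m)) sums (t / u)"
proof -
  have u: "u > 0" "u < 1" using assms by (auto simp: u_def)
  have "(\<lambda>n. - ((- (- u)) ^ n) / of_nat n) sums ln (1 + (- u))"
    using u by (intro ln_series') auto
  hence "(\<lambda>n. - (- (u ^ n) / real n)) sums (- (- t))"
    by (intro sums_minus) (simp add: u_def)
  \<comment> \<open>The term of index 0 has denominator 0, so it is 0 in HOL and drops out when the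
    index is shifted.\<close>
  hence "(\<lambda>n. u ^ Suc n / real (Suc n)) sums t"
    by (subst sums_Suc_iff) simp
  hence "(\<lambda>n. u ^ Suc n / real (Suc n) / u) sums (t / u)"
    by (rule sums_divide)
  moreover have "u ^ Suc n / r / u = u ^ n / r" for n and r :: real
    using u by simp
  ultimately show ?thesis by (simp only:)
qed

text \<open>The part with 1 / (m + 2) is the logarithmic series without its first term 1, divided by
  u, namely (t / u - 1) / u; the part with a - 1 is a multiple of the series itself. Substituting
  exp t - 1 = exp t * u then gives \<open>hurwitz_psi\<close>.\<close>

lemma hurwitz_psi_series:
  fixes t :: real
  assumes "t > 0"
  defines "u \<equiv> 1 - exp (- t)"
  shows "(\<lambda>m. exp (- a * t) * u ^ m * (1 / (real (Suc m) + 1) + (a - 1) / real (Suc m)))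
           sums (hurwitz_psi a t * exp (- (a - 1) * t))"
proof -
  have u: "u > 0" using assms by (simp add: u_def)
  note L = log_series_exp[OF assms(1), folded u_def]
  have "(\<lambda>m. u ^ Suc m / real (Suc (Suc m))) sums (t / u - 1)"
    using L by (subst sums_Suc_iff) simp
  hence "(\<lambda>m. u ^ Suc m / real (Suc (Suc m)) / u) sums ((t / u - 1) / u)"
    by (rule sums_divide)
  moreover have "u ^ Suc n / real (Suc (Suc n)) / u = u ^ n / (real (Suc n) + 1)" for n
    using u by (simp add: add_ac)
  ultimately have "(\<lambda>m. u ^ m / (real (Suc m) + 1)) sums ((t / u - 1) / u)"
    by (simp only:)
  from sums_mult[OF sums_add[OF this sums_mult[OF L, of "a - 1"]], of "exp (- a * t)"]
  have "(\<lambda>m. exp (- a * t) * u ^ m * (1 / (real (Suc m) + 1) + (a - 1) / real (Suc m))) sums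
          (exp (- a * t) * ((t / u - 1) / u + (a - 1) * (t / u)))"
    by (simp add: field_simps)
  also have "exp (- a * t) * ((t / u - 1) / u + (a - 1) * (t / u)) = hurwitz_psi a t * exp (- (a - 1) * t)"
  proof -
    have "exp t - 1 = exp t * u" by (simp add: u_def algebra_simps exp_minus)
    moreover have "exp (- (a - 1) * t) = exp (- a * t) * exp t" by (simp add: exp_add[symmetric] algebra_simps)
    ultimately show ?thesis
      using u by (simp add: hurwitz_psi_def power_mult_distrib) (simp add: field_simps power2_eq_square)
  qed
  finally show ?thesis .
qed

text \<open>One summand is nonnegative, the other nonpositive, and each is at most 1 /
  \<open>Suc m\<close> in absolute value. This makes the logarithmic series a majorant.\<close>

lemma hurwitz_coefficient_bound:
  assumes "0 < a" "a \<le> 1"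
  shows "\<bar>1 / (real (Suc m) + 1) + (a - 1) / real (Suc m)\<bar> \<le> 1 / real (Suc m)"
proof -
  have "1 / (real (Suc m) + 1) \<le> 1 / real (Suc m)" by (intro divide_left_mono) auto
  moreover have "(a - 1) / real (Suc m) \<le> 0" using assms by (simp add: divide_le_0_iff)
  moreover have "(a - 1) / real (Suc m) \<ge> (- 1) / real (Suc m)"
    using assms by (intro divide_right_mono) auto
  ultimately show ?thesis by (auto simp: abs_le_iff) (smt (verit) divide_nonneg_nonneg of_nat_0_le_iff)
qed

section \<open>Integral formula and series for Re s > 0\<close>

theorem theorem1:
  fixes a :: real and s :: complex
  assumes "0 < a" and "a \<le> 1" and "Re s > 0"
  shows "set_integrable lborel {0<..}
           (\<lambda>t::real. of_real (hurwitz_psi a t * exp (- (a - 1) * t)) * of_real t powr (s - 1)) \<and>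
         hurwitz_zeta_entire a s =
           1 / Gamma s * (LINT t:{0<..}|lborel.
             of_real (hurwitz_psi a t * exp (- (a - 1) * t)) * of_real t powr (s - 1)) \<and>
         (\<lambda>m. hurwitz_S (Suc m) s a *
            of_real (1 / (real (Suc m) + 1) + (a - 1) / real (Suc m))) sums hurwitz_zeta_entire a s"
proof -
  note a = assms(1,2) and s = assms(3)
  define g where "g = (\<lambda>t. complex_of_real (hurwitz_psi a t * exp (- (a - 1) * t)))"
  define c where "c = (\<lambda>m. 1 / (real (Suc m) + 1) + (a - 1) / real (Suc m))"
  have g: "g t = - hurwitz_gen_deriv a 1 t" if "t > 0" for t
    using hurwitz_gen_deriv_1[OF that, of a] by (simp add: g_def)
  have int: "set_integrable lborel {0<..} (\<lambda>t. g t * of_real t powr (s - 1))"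
  proof -
    have "set_integrable lborel {0<..} (\<lambda>t. (-1) * (hurwitz_gen_deriv a 1 t * of_real t powr (s - 1)))"
      by (intro set_integrable_mult_right set_integrable_mellin exp_decay_hurwitz_gen_deriv a s)
    thus ?thesis by (rule set_integrable_cong[THEN iffD1, rotated -1]) (auto simp: g)
  qed
  have "mellin g s = (LINT t:{0<..}|lborel. (-1) * (hurwitz_gen_deriv a 1 t * of_real t powr (s - 1)))"
    unfolding mellin_def by (intro set_lebesgue_integral_cong) (auto simp: g)
  hence mellin_g: "mellin g s = - mellin (hurwitz_gen_deriv a 1) s"
    by (simp only: set_integral_mult_right mellin_def) simp
  \<comment> \<open>The piece k = 1 is valid for Re s > 0, and its argument s - 1 + 1 is s; this is
    (A).\<close>
  have zeta: "hurwitz_zeta_entire a s = rGamma s * mellin g s"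
    using zeta_entire_eq[OF a, of 1 s] s
    by (simp add: hurwitz_zeta_entire_eq[OF a] zeta_piece_def mellin_g)
  define h where "h = (\<lambda>m t. complex_of_real (exp (- a * t) * (1 - exp (- t)) ^ m * c m))"
  have c_bound: "\<bar>c m\<bar> \<le> 1 / real (Suc m)" for m
    using hurwitz_coefficient_bound[OF a] by (simp only: c_def)
  have "(\<lambda>m. mellin (h m) s) sums mellin g s"
  proof (rule mellin_sums[where g = "hurwitz_gen_deriv a 0"])
    show "exp_decay (h m)" for m
    proof (rule exp_decayI[where C = 1 and c = a])
      show "continuous_on {0<..} (h m)" unfolding h_def by (intro continuous_intros)
      fix t :: real assume t: "t > 0"
      have "norm (h m t) = exp (- a * t) * ((1 - exp (- t)) ^ m * \<bar>c m\<bar>)"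
        using t by (simp add: h_def norm_mult norm_power abs_mult flip: of_real_power of_real_diff)
      also have "\<dots> \<le> exp (- a * t) * (1 * 1)"
        using t by (intro mult_left_mono mult_mono power_le_one order_trans[OF c_bound]) auto
      finally show "norm (h m t) \<le> 1 * exp (- a * t)" by simp
    qed (use a in auto)
    show "exp_decay (hurwitz_gen_deriv a 0)" by (rule exp_decay_hurwitz_gen_deriv[OF a])
    show "Re s > 0" by fact
    show "(\<lambda>m. h m t) sums g t" if "t > 0" for t
      unfolding h_def g_def sums_of_real_iff c_def using hurwitz_psi_series[OF that] .
    have "continuous_on {0<..} (\<lambda>t. - hurwitz_gen_deriv a 1 t)"
      using exp_decay_hurwitz_gen_deriv[OF a, of 1] by (intro continuous_intros) (auto simp: exp_decay_def)
    thus "continuous_on {0<..} g"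
      by (rule continuous_on_cong[THEN iffD1, rotated -1]) (auto simp: g)
    fix t :: real and n assume t: "t > 0"
    define u where "u = 1 - exp (- t)"
    have u: "u > 0" using t by (simp add: u_def)
    note L = log_series_exp[OF t, folded u_def]
    \<comment> \<open>By the coefficient bound the absolute values add up to at most exp (- a t) *
      (t / u), which is the generating function at t. It thus dominates all partial sums.\<close>
    have "norm (\<Sum>k<n. h k t) \<le> (\<Sum>k<n. norm (h k t))" by (rule norm_sum)
    also have "\<dots> \<le> (\<Sum>k<n. exp (- a * t) * (u ^ k / real (Suc k)))"
    proof (rule sum_mono)
      fix k
      have "norm (h k t) = exp (- a * t) * (u ^ k * \<bar>c k\<bar>)"
        using u unfolding h_def u_def[symmetric] norm_of_real by (simp add: abs_mult)
      also have "\<dots> \<le> exp (- a * t) * (u ^ k * (1 / real (Suc k)))"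
        using u by (intro mult_left_mono c_bound) auto
      finally show "norm (h k t) \<le> exp (- a * t) * (u ^ k / real (Suc k))" by simp
    qed
    also have "\<dots> \<le> exp (- a * t) * (t / u)"
      unfolding sum_distrib_left[symmetric]
      using sum_le_suminf[of "\<lambda>k. u ^ k / real (Suc k)" "{..<n}"] L u
      by (intro mult_left_mono) (auto simp: sums_iff)
    also have "exp (- a * t) * (t / u) = t * exp ((1 - a) * t) / (exp t - 1)"
    proof -
      have "exp t - 1 = exp t * u" by (simp add: u_def algebra_simps exp_minus)
      moreover have "exp ((1 - a) * t) = exp (- a * t) * exp t" by (simp add: exp_add[symmetric] algebra_simps)
      ultimately show ?thesis using u by simp
    qed
    also have "\<dots> = norm (hurwitz_gen_deriv a 0 t)"
      using t by (simp add: hurwitz_gen_deriv_def hurwitz_gen_of_real del: of_real_mult of_real_divide)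
    finally show "norm (\<Sum>k<n. h k t) \<le> norm (hurwitz_gen_deriv a 0 t)" .
  qed
  also have "(\<lambda>m. mellin (h m) s) = (\<lambda>m. Gamma s * hurwitz_S (Suc m) s a * of_real (c m))"
  proof
    fix m
    have "mellin (h m) s = (LINT t:{0<..}|lborel. of_real (c m) *
            (of_real (exp (- a * t) * (1 - exp (- t)) ^ m) * complex_of_real t powr (s - 1)))"
      unfolding mellin_def h_def by (intro set_lebesgue_integral_cong) (auto simp: mult_ac)
    also have "\<dots> = of_real (c m) * mellin (\<lambda>t. of_real (exp (- a * t) * (1 - exp (- t)) ^ m)) s"
      unfolding mellin_def by (rule set_integral_mult_right)
    finally show "mellin (h m) s = Gamma s * hurwitz_S (Suc m) s a * of_real (c m)"
      using mellin_binomial_exp[OF a(1) s, of m] by (simp only: mult_ac)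
  qed
  finally have "(\<lambda>m. rGamma s * (Gamma s * hurwitz_S (Suc m) s a * of_real (c m))) sums (rGamma s * mellin g s)"
    by (rule sums_mult)
  moreover have "Gamma s \<noteq> 0"
    using s by (auto simp: Gamma_eq_zero_iff elim!: nonpos_Ints_cases)
  ultimately have "(\<lambda>m. hurwitz_S (Suc m) s a * of_real (c m)) sums hurwitz_zeta_entire a s"
    by (simp add: rGamma_inverse_Gamma zeta mult.assoc[symmetric])
  moreover have "hurwitz_zeta_entire a s = 1 / Gamma s * (LINT t:{0<..}|lborel. g t * of_real t powr (s - 1))"
    by (simp add: zeta mellin_def rGamma_inverse_Gamma field_simps)
  ultimately show ?thesis
    using int unfolding g_def c_def by blast
qed

end
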